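(* For every positive integer $n$, the Catalan matroid $\mathbf{C}_n$ is self-dual, i.e. $\mathbf{C}_n \cong \mathbf{C}_n^{*}$, where $\mathbf{C}_n^{*}$ denotes the dual matroid.
   Context: A Dyck path of length $2n$ is a path in the plane from $(0,0)$ to $(2n,0)$, with steps $(1,1)$ (up-steps) and $(1,-1)$ (down-steps), that never passes below the $x$-axis. Its up-step set is the set of $i\in[2n]=\{1,\dots,2n\}$ for which the $i$-th step is an up-step. The Catalan matroid $\mathbf{C}_n$ is the matroid on the ground set $[2n]$ whose bases are the up-step sets of all Dyck paths of length $2n$. A matroid $M$ is called self-dual if $M$ is isomorphic to its dual $M^*$ (equality $M=M^*$ is not required). *)

theory Defs
  imports Main "HOL-Library.Product_Plus"
begin

section \<open>Matroids\<close>

definition matroid_bases :: "'a set \<Rightarrow> 'a set set \<Rightarrow> bool" where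
  "matroid_bases E \<B> \<longleftrightarrow>
     finite E \<and> \<B> \<subseteq> Pow E \<and> \<B> \<noteq> {} \<and>
     (\<forall>A\<in>\<B>. \<forall>B\<in>\<B>. \<forall>x\<in>A - B. \<exists>y\<in>B - A. insert y (A - {x}) \<in> \<B>)"

typedef 'a matroid = "{(E :: 'a set, \<B>). matroid_bases E \<B>}"
proof
  show "({}, {{}}) \<in> {(E :: 'a set, \<B>). matroid_bases E \<B>}"
    by (simp add: matroid_bases_def)
qed

definition ground :: "'a matroid \<Rightarrow> 'a set" where
  "ground M = fst (Rep_matroid M)"

definition bases :: "'a matroid \<Rightarrow> 'a set set" where
  "bases M = snd (Rep_matroid M)"

text \<open>
  \<open>Matroid E \<B>\<close> is only meaningful if \<open>\<B>\<close> satisfies the basis axioms on \<open>E\<close>; for the two uses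
  below (the dual and the Catalan matroid) this is proved.
\<close>

definition Matroid :: "'a set \<Rightarrow> 'a set set \<Rightarrow> 'a matroid" where
  "Matroid E \<B> = Abs_matroid (E, \<B>)"

lemma matroid_bases_ground: "matroid_bases (ground M) (bases M)"
  using Rep_matroid[of M] by (auto simp: ground_def bases_def)

lemma ground_Matroid: "matroid_bases E \<B> \<Longrightarrow> ground (Matroid E \<B>) = E"
  by (simp add: ground_def Matroid_def Abs_matroid_inverse)

lemma bases_Matroid: "matroid_bases E \<B> \<Longrightarrow> bases (Matroid E \<B>) = \<B>"
  by (simp add: bases_def Matroid_def Abs_matroid_inverse)

definition matroid_iso :: "'a matroid \<Rightarrow> 'b matroid \<Rightarrow> bool" where
  "matroid_iso M N \<longleftrightarrow>
     (\<exists>f. bij_betw f (ground M) (ground N) \<and>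
          (\<forall>B\<subseteq>ground M. B \<in> bases M \<longleftrightarrow> f ` B \<in> bases N))"

definition dual :: "'a matroid \<Rightarrow> 'a matroid" where
  "dual M = Matroid (ground M) ((\<lambda>B. ground M - B) ` bases M)"

definition self_dual :: "'a matroid \<Rightarrow> bool" where
  "self_dual M \<longleftrightarrow> matroid_iso M (dual M)"

lemma matroid_bases_exchange:
  assumes "matroid_bases E \<B>" "A \<in> \<B>" "B \<in> \<B>" "x \<in> A" "x \<notin> B"
  obtains y where "y \<in> B" "y \<notin> A" "insert y (A - {x}) \<in> \<B>"
proof -
  have "\<forall>A\<in>\<B>. \<forall>B\<in>\<B>. \<forall>x\<in>A - B. \<exists>y\<in>B - A. insert y (A - {x}) \<in> \<B>"
    using assms(1) by (simp add: matroid_bases_def)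
  then have "\<exists>y\<in>B - A. insert y (A - {x}) \<in> \<B>"
    using assms(2-5) by (meson DiffI)
  then show ?thesis using that by (meson DiffD1 DiffD2)
qed

lemma matroid_bases_finite:
  assumes "matroid_bases E \<B>" "A \<in> \<B>"
  shows "finite A" "A \<subseteq> E"
proof -
  have E: "finite E" "\<B> \<subseteq> Pow E" using assms(1) by (simp_all add: matroid_bases_def)
  show "A \<subseteq> E" using E(2) assms(2) by blast
  then show "finite A" using E(1) by (rule finite_subset)
qed

lemma card_swap:
  assumes "finite A" "x \<in> A" "y \<notin> A"
  shows "card (insert y (A - {x})) = card A"
  using assms card_Suc_Diff1[of A x] by simp

lemma matroid_bases_card_le:
  assumes M: "matroid_bases E \<B>" and "A \<in> \<B>" "B \<in> \<B>"
  shows "card A \<le> card B"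
  using assms(2)
proof (induction "card (A - B)" arbitrary: A rule: less_induct)
  case less
  note fin = matroid_bases_finite(1)[OF M]
  show ?case
  proof (cases "A \<subseteq> B")
    case True
    then show ?thesis using fin[OF \<open>B \<in> \<B>\<close>] by (simp add: card_mono)
  next
    case False
    then obtain x where x: "x \<in> A" "x \<notin> B" by blast
    obtain y where y: "y \<in> B" "y \<notin> A" "insert y (A - {x}) \<in> \<B>"
      using matroid_bases_exchange[OF M less.prems \<open>B \<in> \<B>\<close> x] .
    have "insert y (A - {x}) - B = (A - B) - {x}" using y by auto
    then have "card (insert y (A - {x}) - B) < card (A - B)"
      using x fin[OF less.prems] by (simp add: card_Diff1_less del: card_Diff_insert)
    then have "card (insert y (A - {x})) \<le> card B" using less.hyps y(3) by blast
    moreover have "card (insert y (A - {x})) = card A"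
      using x y fin[OF less.prems] by (intro card_swap)
    ultimately show ?thesis by simp
  qed
qed

lemma matroid_bases_dual_exchange:
  assumes M: "matroid_bases E \<B>" and A: "A \<in> \<B>" and B: "B \<in> \<B>" and x: "x \<in> B" "x \<notin> A"
  obtains y where "y \<in> A" "y \<notin> B" "insert x (A - {y}) \<in> \<B>"
proof -
  note fin = matroid_bases_finite(1)[OF M]
  define P where "P C \<longleftrightarrow> C \<in> \<B> \<and> insert x (A \<inter> B) \<subseteq> C \<and> C \<subseteq> A \<union> B" for C
  have "P B" using B x by (auto simp: P_def)
  then obtain C where C: "P C" and min: "\<And>D. P D \<Longrightarrow> card (C - A) \<le> card (D - A)"
    using ex_has_least_nat[of P B "\<lambda>C. card (C - A)"] by blast
  have C': "C \<in> \<B>" "x \<in> C" "A \<inter> B \<subseteq> C" "C \<subseteq> A \<union> B" using C by (auto simp: P_def)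
  have "z = x" if z: "z \<in> C" "z \<notin> A" for z
  proof (rule ccontr)
    assume "z \<noteq> x"
    obtain y where y: "y \<in> A" "y \<notin> C" "insert y (C - {z}) \<in> \<B>"
      using matroid_bases_exchange[OF M C'(1) A z] .
    have "P (insert y (C - {z}))" using y z C' \<open>z \<noteq> x\<close> by (auto simp: P_def)
    moreover have "insert y (C - {z}) - A = (C - A) - {z}" using y by auto
    moreover have "card ((C - A) - {z}) < card (C - A)"
      using z fin[OF C'(1)] by (intro card_Diff1_less) auto
    ultimately show False using min by fastforce
  qed
  then have CA: "C - A = {x}" using C' x by blast
  have "card C = card A"
    using matroid_bases_card_le[OF M] A C'(1) by (meson le_antisym)
  then have "card (A - C) = card (C - A)"
    using fin[OF A] fin[OF C'(1)] by (metis card_le_sym_Diff le_antisym order_refl)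
  then obtain y where y: "A - C = {y}" using CA by (auto simp: card_1_singleton_iff)
  have "C = insert x (A - {y})" using CA y by blast
  then show ?thesis using that[of y] y C' by blast
qed

lemma matroid_bases_dual:
  assumes M: "matroid_bases E \<B>"
  shows "matroid_bases E ((\<lambda>B. E - B) ` \<B>)"
proof -
  have "\<exists>y\<in>(E - B) - (E - A). insert y ((E - A) - {x}) \<in> (\<lambda>B. E - B) ` \<B>"
    if AB: "A \<in> \<B>" "B \<in> \<B>" and x: "x \<in> (E - A) - (E - B)" for A B x
  proof -
    have sub: "A \<subseteq> E" "B \<subseteq> E" using matroid_bases_finite(2)[OF M] AB by auto
    have x': "x \<in> B" "x \<notin> A" using x by auto
    obtain y where y: "y \<in> A" "y \<notin> B" "insert x (A - {y}) \<in> \<B>"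
      using matroid_bases_dual_exchange[OF M AB x'] .
    have "insert y ((E - A) - {x}) = E - insert x (A - {y})" using y x sub by auto
    then show ?thesis using y sub by (intro bexI[of _ y]) auto
  qed
  then show ?thesis using M unfolding matroid_bases_def by (simp add: image_subset_iff)
qed

lemma ground_dual: "ground (dual M) = ground M"
  and bases_dual: "bases (dual M) = (\<lambda>B. ground M - B) ` bases M"
  using matroid_bases_dual[OF matroid_bases_ground[of M]]
  by (simp_all add: dual_def ground_Matroid bases_Matroid)


section \<open>Dyck paths and the Catalan matroid\<close>

datatype step = Up | Down

fun step_vec :: "step \<Rightarrow> int \<times> int" where
  "step_vec Up = (1, 1)"
| "step_vec Down = (1, -1)"

text \<open>The point reached from the origin after the first \<open>k\<close> steps.\<close>

definition vertex :: "step list \<Rightarrow> nat \<Rightarrow> int \<times> int" where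
  "vertex s k = sum_list (map step_vec (take k s))"

definition dyck_path :: "nat \<Rightarrow> step list \<Rightarrow> bool" where
  "dyck_path n s \<longleftrightarrow>
     length s = 2 * n \<and> vertex s (2 * n) = (2 * int n, 0) \<and> (\<forall>k\<le>2 * n. 0 \<le> snd (vertex s k))"

text \<open>Steps are numbered from 1, list positions from 0.\<close>

definition up_steps :: "step list \<Rightarrow> nat set" where
  "up_steps s = {i \<in> {1..length s}. s ! (i - 1) = Up}"

definition catalan_bases :: "nat \<Rightarrow> nat set set" where
  "catalan_bases n = {up_steps s | s. dyck_path n s}"

definition catalan_matroid :: "nat \<Rightarrow> nat matroid" where
  "catalan_matroid n = Matroid {1..2 * n} (catalan_bases n)"

lemma vertex_eq:
  "k \<le> length s \<Longrightarrow> vertex s k = (int k, 2 * int (card (up_steps s \<inter> {1..k})) - int k)"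
proof (induction k)
  case 0
  then show ?case by (simp add: vertex_def zero_prod_def)
next
  case (Suc k)
  have v: "vertex s (Suc k) = vertex s k + step_vec (s ! k)"
    using Suc.prems by (simp add: vertex_def take_Suc_conv_app_nth)
  show ?case
  proof (cases "s ! k")
    case Up
    then have "up_steps s \<inter> {1..Suc k} = insert (Suc k) (up_steps s \<inter> {1..k})"
      using Suc.prems by (auto simp: up_steps_def le_Suc_eq)
    then show ?thesis using Suc Up v by simp
  next
    case Down
    then have "up_steps s \<inter> {1..Suc k} = up_steps s \<inter> {1..k}"
      by (auto simp: up_steps_def le_Suc_eq)
    then show ?thesis using Suc Down v by simp
  qed
qed

lemma mem_catalan_bases_iff:
  "A \<in> catalan_bases n \<longleftrightarrow>
     A \<subseteq> {1..2 * n} \<and> card A = n \<and> (\<forall>k\<le>2 * n. k \<le> 2 * card (A \<inter> {1..k}))"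
proof
  assume "A \<in> catalan_bases n"
  then obtain s where s: "dyck_path n s" "A = up_steps s" by (auto simp: catalan_bases_def)
  have len: "length s = 2 * n" using s by (simp add: dyck_path_def)
  have sub: "A \<subseteq> {1..2 * n}" using s len by (auto simp: up_steps_def)
  have "A \<inter> {1..2 * n} = A" using sub by blast
  moreover have "vertex s (2 * n) = (2 * int n, 0)" using s by (simp add: dyck_path_def)
  ultimately have "card A = n" using vertex_eq[of "2 * n" s] len s(2) by simp
  moreover have "k \<le> 2 * card (A \<inter> {1..k})" if "k \<le> 2 * n" for k
  proof -
    have "0 \<le> snd (vertex s k)" using s that by (simp add: dyck_path_def)
    then show ?thesis using vertex_eq[of k s] len that s(2) by simp
  qed
  ultimately show "A \<subseteq> {1..2 * n} \<and> card A = n \<and> (\<forall>k\<le>2 * n. k \<le> 2 * card (A \<inter> {1..k}))"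
    using sub by blast
next
  assume A: "A \<subseteq> {1..2 * n} \<and> card A = n \<and> (\<forall>k\<le>2 * n. k \<le> 2 * card (A \<inter> {1..k}))"
  define s where "s = map (\<lambda>i. if Suc i \<in> A then Up else Down) [0..<2 * n]"
  have len: "length s = 2 * n" by (simp add: s_def)
  have up: "up_steps s = A"
  proof (rule set_eqI)
    fix i
    show "i \<in> up_steps s \<longleftrightarrow> i \<in> A"
      using A by (cases i) (auto simp: up_steps_def s_def split: if_splits)
  qed
  have "A \<inter> {1..2 * n} = A" using A by blast
  then have "vertex s (2 * n) = (2 * int n, 0)"
    using vertex_eq[of "2 * n" s] len up A by simp
  moreover have "0 \<le> snd (vertex s k)" if "k \<le> 2 * n" for k
  proof -
    have "k \<le> 2 * card (A \<inter> {1..k})" using A that by blast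
    then show ?thesis using vertex_eq[of k s] len up that by simp
  qed
  ultimately have "dyck_path n s" using len by (simp add: dyck_path_def)
  then show "A \<in> catalan_bases n" using up by (auto simp: catalan_bases_def)
qed

lemma matroid_bases_catalan: "matroid_bases {1..2 * n} (catalan_bases n)"
proof -
  have "\<exists>y\<in>B - A. insert y (A - {x}) \<in> catalan_bases n"
    if AB: "A \<in> catalan_bases n" "B \<in> catalan_bases n" and x: "x \<in> A - B" for A B x
  proof -
    have A: "A \<subseteq> {1..2 * n}" "card A = n" "\<And>k. k \<le> 2 * n \<Longrightarrow> k \<le> 2 * card (A \<inter> {1..k})"
      using AB(1) by (auto simp: mem_catalan_bases_iff)
    have B: "B \<subseteq> {1..2 * n}" "card B = n" "\<And>k. k \<le> 2 * n \<Longrightarrow> k \<le> 2 * card (B \<inter> {1..k})"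
      using AB(2) by (auto simp: mem_catalan_bases_iff)
    have fin: "finite A" "finite B" using A(1) B(1) by (auto intro: finite_subset)
    have ne: "B - A \<noteq> {}"
    proof
      assume "B - A = {}"
      then have "B \<subseteq> A" by blast
      then have "B = A" using fin A(2) B(2) by (simp add: card_subset_eq)
      then show False using x by blast
    qed
    define y where "y = Min (B - A)"
    have y: "y \<in> B - A" unfolding y_def using ne fin by (intro Min_in) auto
    have y_le: "z \<in> A" if "z \<in> B" "z < y" for z
      using that fin Min_le[of "B - A" z] unfolding y_def by fastforce
    let ?C = "insert y (A - {x})"
    have "?C \<subseteq> {1..2 * n}" using A(1) B(1) y by auto
    moreover have "card ?C = n"
      using card_swap[of A x y] x y fin A(2) by simp
    moreover have "k \<le> 2 * card (?C \<inter> {1..k})" if k: "k \<le> 2 * n" for k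
    proof (cases "y \<le> k")
      case True
      have "card (A \<inter> {1..k}) \<le> card (?C \<inter> {1..k})"
      proof -
        have "1 \<le> y" using y B(1) by auto
        then have C: "?C \<inter> {1..k} = insert y ((A \<inter> {1..k}) - {x})" using True by auto
        have "card (insert y ((A \<inter> {1..k}) - {x})) = Suc (card ((A \<inter> {1..k}) - {x}))"
          using y fin by (intro card_insert_disjoint) auto
        moreover have "card (A \<inter> {1..k}) - 1 \<le> card ((A \<inter> {1..k}) - {x})"
          by (simp add: card_Diff_singleton_if)
        ultimately show ?thesis unfolding C by linarith
      qed
      then show ?thesis using A(3)[OF k] by linarith
    next
      case False
      have "B \<inter> {1..k} \<subseteq> ?C \<inter> {1..k}" using y_le False x by force
      then have "card (B \<inter> {1..k}) \<le> card (?C \<inter> {1..k})" using fin by (intro card_mono) auto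
      then show ?thesis using B(3)[OF k] by linarith
    qed
    ultimately have "?C \<in> catalan_bases n" by (simp add: mem_catalan_bases_iff)
    then show ?thesis using y by blast
  qed
  moreover have "catalan_bases n \<noteq> {}"
  proof -
    have "{1..n} \<inter> {1..k} = {1..min n k}" for k by auto
    then have "{1..n} \<in> catalan_bases n" by (auto simp: mem_catalan_bases_iff min_def)
    then show ?thesis by blast
  qed
  moreover have "catalan_bases n \<subseteq> Pow {1..2 * n}" using mem_catalan_bases_iff by blast
  ultimately show ?thesis unfolding matroid_bases_def by blast
qed

lemma ground_catalan_matroid: "ground (catalan_matroid n) = {1..2 * n}"
  and bases_catalan_matroid: "bases (catalan_matroid n) = catalan_bases n"
  using matroid_bases_catalan[of n]
  by (simp_all add: catalan_matroid_def ground_Matroid bases_Matroid)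

end

theory Submission
  imports Defs
begin

text \<open>
  Reflecting a Dyck path in the vertical line through its midpoint exchanges up-steps and
  down-steps. Hence the reflection \<open>i \<mapsto> 2n + 1 - i\<close> of the ground set sends bases to complements
  of bases.
\<close>

definition reflect_compl :: "nat \<Rightarrow> nat set \<Rightarrow> nat set" where
  "reflect_compl n A = {1..2 * n} - (\<lambda>i. 2 * n + 1 - i) ` A"

lemma bij_betw_reflect: "bij_betw (\<lambda>i. m + 1 - i) {1..m} {1..m::nat}"
  by (rule bij_betw_byWitness[where f' = "\<lambda>i. m + 1 - i"]) auto

text \<open>On \<open>{1..2 * n}\<close> the reflection is its own inverse, so membership in an
  image becomes a condition on the reflected point.\<close>

lemma mem_reflect_compl_iff:
  assumes "A \<subseteq> {1..2 * n}"
  shows "i \<in> reflect_compl n A \<longleftrightarrow> i \<in> {1..2 * n} \<and> 2 * n + 1 - i \<notin> A"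
proof (cases "i \<in> {1..2 * n}")
  case True
  have "i \<in> (\<lambda>j. 2 * n + 1 - j) ` A \<longleftrightarrow> 2 * n + 1 - i \<in> A"
  proof
    assume "2 * n + 1 - i \<in> A"
    then show "i \<in> (\<lambda>j. 2 * n + 1 - j) ` A"
      using True by (intro image_eqI[of _ _ "2 * n + 1 - i"]) auto
  next
    assume "i \<in> (\<lambda>j. 2 * n + 1 - j) ` A"
    then obtain j where j: "j \<in> A" "i = 2 * n + 1 - j" by blast
    then have "j \<in> {1..2 * n}" using assms by blast
    then have "2 * n + 1 - i = j" using j by auto
    then show "2 * n + 1 - i \<in> A" using j by simp
  qed
  then show ?thesis using True by (simp add: reflect_compl_def)
qed (auto simp: reflect_compl_def)

lemma reflect_compl_subset: "reflect_compl n A \<subseteq> {1..2 * n}"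
  by (auto simp: reflect_compl_def)

lemma reflect_compl_involution:
  assumes "A \<subseteq> {1..2 * n}"
  shows "reflect_compl n (reflect_compl n A) = A"
proof (rule set_eqI)
  fix i
  have "i \<in> A \<Longrightarrow> i \<in> {1..2 * n}" using assms by blast
  then show "i \<in> reflect_compl n (reflect_compl n A) \<longleftrightarrow> i \<in> A"
    by (auto simp: mem_reflect_compl_iff[OF reflect_compl_subset] mem_reflect_compl_iff[OF assms])
qed

text \<open>The complement removes from \<open>{1..k}\<close> exactly the reflections of the
  elements of \<open>A\<close> beyond \<open>2 * n - k\<close>. The count is written as a sum to
  avoid truncated subtraction on \<open>nat\<close>.\<close>

lemma card_reflect_compl_prefix:
  assumes A: "A \<subseteq> {1..2 * n}" and k: "k \<le> 2 * n"
  shows "card (reflect_compl n A \<inter> {1..k}) + card A = k + card (A \<inter> {1..2 * n - k})"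
proof -
  let ?f = "\<lambda>i. 2 * n + 1 - i"
  let ?T = "A - {1..2 * n - k}"
  have finA: "finite A" using A by (rule finite_subset) simp
  have "inj_on ?f A"
    using bij_betw_imp_inj_on[OF bij_betw_reflect[of "2 * n"]] A by (rule inj_on_subset)
  then have "card (?f ` ?T) = card ?T" by (intro card_image) (auto intro: inj_on_subset)
  moreover have sub: "?f ` ?T \<subseteq> {1..k}"
  proof
    fix i
    assume "i \<in> ?f ` ?T"
    then obtain j where j: "j \<in> A" "j \<notin> {1..2 * n - k}" "i = ?f j" by blast
    then have "j \<in> {1..2 * n}" using A by blast
    then show "i \<in> {1..k}" using j k by auto
  qed
  moreover have "reflect_compl n A \<inter> {1..k} = {1..k} - ?f ` ?T"
  proof -
    \<comment> \<open>Only the last \<open>k\<close> positions are reflected into the first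
      \<open>k\<close>, so \<open>?T\<close> accounts for all that is removed there.\<close>
    have "j \<notin> {1..2 * n - k}" if "?f j \<in> {1..k}" for j
      using that k by auto
    then have "?f ` A \<inter> {1..k} \<subseteq> ?f ` ?T" by blast
    then have "{1..k} - ?f ` A = {1..k} - ?f ` ?T" by blast
    moreover have "{1..k} \<subseteq> {1..2 * n}" using k by auto
    ultimately show ?thesis unfolding reflect_compl_def by blast
  qed
  \<comment> \<open>The inclusion \<open>sub\<close> also bounds \<open>card ?T\<close> by
    \<open>k\<close>, so that the difference of cardinalities is exact.\<close>
  ultimately have "card (reflect_compl n A \<inter> {1..k}) + card ?T = k"
    using card_mono[OF _ sub] finA by (simp add: card_Diff_subset)
  moreover have "card A = card (A \<inter> {1..2 * n - k}) + card ?T"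
    using card_Int_Diff[OF finA] .
  ultimately show ?thesis by linarith
qed

text \<open>Twice the prefix count at \<open>k\<close> is \<open>2 * k - 2 * n\<close> plus twice
  the count of \<open>A\<close> at \<open>2 * n - k\<close>. The latter is at least
  \<open>2 * n - k\<close>, which leaves at least \<open>k\<close>.\<close>

lemma reflect_compl_catalan_bases:
  assumes "A \<in> catalan_bases n"
  shows "reflect_compl n A \<in> catalan_bases n"
proof -
  have A: "A \<subseteq> {1..2 * n}" "card A = n" "\<And>k. k \<le> 2 * n \<Longrightarrow> k \<le> 2 * card (A \<inter> {1..k})"
    using assms by (auto simp: mem_catalan_bases_iff)
  note prefix = card_reflect_compl_prefix[OF A(1)]
  have "reflect_compl n A \<inter> {1..2 * n} = reflect_compl n A"
    using reflect_compl_subset by blast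
  \<comment> \<open>At \<open>k = 2 * n\<close> the remaining prefix \<open>{1..0}\<close> of
    \<open>A\<close> is empty.\<close>
  then have "card (reflect_compl n A) = n" using prefix[of "2 * n"] A(2) by simp
  moreover have "k \<le> 2 * card (reflect_compl n A \<inter> {1..k})" if "k \<le> 2 * n" for k
    using prefix[OF that] A(3)[of "2 * n - k"] A(2) that by linarith
  ultimately show ?thesis using reflect_compl_subset unfolding mem_catalan_bases_iff by blast
qed

theorem proposition2p8:
  fixes n :: nat
  assumes "n \<ge> 1"
  shows "self_dual (catalan_matroid n)"
proof -
  let ?E = "{1..2 * n}" and ?f = "\<lambda>i. 2 * n + 1 - i"
  have "B \<in> catalan_bases n \<longleftrightarrow> ?f ` B \<in> (\<lambda>C. ?E - C) ` catalan_bases n" if B: "B \<subseteq> ?E" for B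
  proof -
    have "?f ` B \<subseteq> ?E" using bij_betw_imp_surj_on[OF bij_betw_reflect[of "2 * n"]] B by blast
    then have compl: "?E - reflect_compl n B = ?f ` B" by (auto simp: reflect_compl_def)
    \<comment> \<open>Complementation is injective on subsets of \<open>?E\<close>, so the only
      candidate for \<open>C\<close> is \<open>reflect_compl n B\<close>.\<close>
    have "?f ` B \<in> (\<lambda>C. ?E - C) ` catalan_bases n \<longleftrightarrow> reflect_compl n B \<in> catalan_bases n"
    proof
      assume "?f ` B \<in> (\<lambda>C. ?E - C) ` catalan_bases n"
      then obtain C where C: "C \<in> catalan_bases n" "?f ` B = ?E - C" by blast
      then have "C \<subseteq> ?E" by (simp add: mem_catalan_bases_iff)
      then have "reflect_compl n B = C" unfolding reflect_compl_def C(2) by blast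
      then show "reflect_compl n B \<in> catalan_bases n" using C(1) by simp
    next
      assume "reflect_compl n B \<in> catalan_bases n"
      then show "?f ` B \<in> (\<lambda>C. ?E - C) ` catalan_bases n" using compl by blast
    qed
    \<comment> \<open>Preservation of bases under an involution yields both directions.\<close>
    also have "\<dots> \<longleftrightarrow> B \<in> catalan_bases n"
      using reflect_compl_catalan_bases reflect_compl_involution[OF B] by metis
    finally show ?thesis by blast
  qed
  then show ?thesis
    using bij_betw_reflect[of "2 * n"]
    unfolding self_dual_def matroid_iso_def ground_dual bases_dual ground_catalan_matroid
      bases_catalan_matroid
    by blast
qed

end
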